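(* Every valid formula is derivable in the system $\mathbf{Mp}$.
   Context: Formulas are built from literals, namely propositional variables $P,Q,\dots$ and their formal complements $\bar P,\bar Q,\dots$, using the binary connectives $\wedge$ and $\vee$. Negation is the operation $\neg P=\bar P$, $\neg\bar P=P$, extended by De Morgan's laws. A sequent is a nonempty finite multiset of formulas. A comma denotes multiset union, and $\Gamma,\Delta,\Sigma$ denote possibly empty multisets of formulas. A formula is valid if it evaluates to $1$ under every $0/1$-assignment to its variables, with $\bar P$ read as the complement of $P$. The system $\mathbf{Mp}$ has the following rules: - Axiom: infer $P,\neg P$ from no premises, for each propositional variable $P$. - Blended conjunction $(\wedge)$: from $\Gamma,\Delta,A$ and $\Gamma,\Sigma,B$ infer $\Gamma,\Delta,\Sigma,A\wedge B$. - $(\mathrm{par})$: from $\Gamma,A,B$ infer $\Gamma,A\vee B$. - $(\oplus_i)$ for $i=1,2$: from $\Gamma,A_i$ infer $\Gamma,A_1\vee A_2$. A formula is derivable if the one-element sequent consisting of it is the root of a finite derivation tree built from these rules. *)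

theory Defs
  imports "HOL-Library.Multiset"
begin

datatype 'v form =
    Var 'v
  | CoVar 'v
  | And "'v form" "'v form"  (infixr "\<^bold>\<and>" 70)
  | Or "'v form" "'v form"  (infixr "\<^bold>\<or>" 65)

text \<open>Formulas are in negation normal form: \<open>CoVar p\<close> is the formal complement of the
  variable \<open>p\<close>, and negation is an operation on formulas, not a connective.\<close>

fun neg :: "'v form \<Rightarrow> 'v form" where
  "neg (Var p) = CoVar p"
| "neg (CoVar p) = Var p"
| "neg (A \<^bold>\<and> B) = neg A \<^bold>\<or> neg B"
| "neg (A \<^bold>\<or> B) = neg A \<^bold>\<and> neg B"

fun eval :: "('v \<Rightarrow> bool) \<Rightarrow> 'v form \<Rightarrow> bool" where
  "eval \<nu> (Var p) \<longleftrightarrow> \<nu> p"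
| "eval \<nu> (CoVar p) \<longleftrightarrow> \<not> \<nu> p"
| "eval \<nu> (A \<^bold>\<and> B) \<longleftrightarrow> eval \<nu> A \<and> eval \<nu> B"
| "eval \<nu> (A \<^bold>\<or> B) \<longleftrightarrow> eval \<nu> A \<or> eval \<nu> B"

definition valid :: "'v form \<Rightarrow> bool" where
  "valid A \<longleftrightarrow> (\<forall>\<nu>. eval \<nu> A)"

type_synonym 'v sequent = "'v form multiset"

text \<open>\<open>Mp \<Gamma>\<close> states that the sequent \<open>\<Gamma>\<close> is the root of a finite derivation tree. The side
  formulas \<open>\<Gamma>\<close>, \<open>\<Delta>\<close>, \<open>\<Sigma>\<close> of the rules may be empty. Sequents are nonempty by definition; no
  restriction of the type is needed for this, see \<open>Mp_nonempty\<close>.\<close>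

inductive Mp :: "'v sequent \<Rightarrow> bool" where
  ax: "Mp {# Var p, neg (Var p) #}"
| conj: "Mp (\<Gamma> + \<Delta> + {# A #}) \<Longrightarrow> Mp (\<Gamma> + \<Sigma> + {# B #}) \<Longrightarrow> Mp (\<Gamma> + \<Delta> + \<Sigma> + {# A \<^bold>\<and> B #})"
| par: "Mp (\<Gamma> + {# A, B #}) \<Longrightarrow> Mp (\<Gamma> + {# A \<^bold>\<or> B #})"
| oplus1: "Mp (\<Gamma> + {# A #}) \<Longrightarrow> Mp (\<Gamma> + {# A \<^bold>\<or> B #})"
| oplus2: "Mp (\<Gamma> + {# B #}) \<Longrightarrow> Mp (\<Gamma> + {# A \<^bold>\<or> B #})"

lemma Mp_nonempty: "Mp \<Gamma> \<Longrightarrow> \<Gamma> \<noteq> {#}"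
  by (induction rule: Mp.induct) simp_all

definition derivable :: "'v form \<Rightarrow> bool" where
  "derivable A \<longleftrightarrow> Mp {# A #}"

end

theory Submission
  imports Defs
begin

text \<open>By induction on the total size of its formulas, every valid sequent contains a derivable
  subsequent: the rules for \<open>\<and>\<close> and \<open>par\<close>
  preserve validity from conclusion to premises, a superfluous disjunct is absorbed by
  \<open>\<oplus>\<^sub>i\<close>, and the contexts of the two premises of a conjunction are blended into their least
  common supersequent, which stays inside the given context. A subsequent of a one-element sequent
  is the sequent itself, because derivable sequents are nonempty.\<close>

definition valid_sequent :: "'v sequent \<Rightarrow> bool" where
  "valid_sequent \<Gamma> \<longleftrightarrow> (\<forall>\<nu>. \<exists>A\<in>#\<Gamma>. eval \<nu> A)"

text \<open>Tells whether a derivable subsequent of a premise needs the active formula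
  \<open>a\<close>. The split is on membership of \<open>a\<close> in \<open>S\<close>, so further
  copies of \<open>a\<close> in \<open>M\<close> do no harm.\<close>

lemma subseteq_add_mset_cases:
  assumes "S \<subseteq># add_mset a M"
  obtains "S \<subseteq># M" | T where "S = add_mset a T" "T \<subseteq># M"
proof (cases "a \<in># S")
  case True
  then obtain T where "S = add_mset a T"
    by (meson mset_add)
  with assms that(2) show ?thesis
    by (simp add: mset_subset_eq_add_mset_cancel)
next
  case False
  with assms that(1) show ?thesis
    by (metis add_mset_add_single diff_single_trivial subset_eq_diff_conv)
qed

text \<open>Blending with shared context \<open>S \<inter># T\<close> and private contexts
  \<open>S - T\<close> and \<open>T - S\<close> gives each formula its larger multiplicity, so
  nothing is duplicated needlessly.\<close>

lemma Mp_conj_union: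
  assumes "Mp (add_mset A S)" and "Mp (add_mset B T)"
  shows "Mp (add_mset (A \<^bold>\<and> B) (S \<union># T))"
proof -
  have S: "S \<inter># T + (S - T) = S"
    by (auto simp: multiset_eq_iff min_def max_def)
  have T: "S \<inter># T + (T - S) = T"
    by (auto simp: multiset_eq_iff min_def max_def)
  have U: "S + (T - S) = S \<union># T"
    by (auto simp: multiset_eq_iff min_def max_def)
  show ?thesis
    using conj[of "S \<inter># T" "S - T" A "T - S" B] assms
    unfolding S T U by simp
qed

lemma valid_sequent_literals:
  assumes "valid_sequent \<Gamma>"
    and lit: "\<And>A. A \<in># \<Gamma> \<Longrightarrow> (\<exists>p. A = Var p \<or> A = CoVar p)"
  shows "\<exists>p. {# Var p, neg (Var p) #} \<subseteq># \<Gamma>"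
proof -
  \<comment> \<open>This assignment falsifies every \<open>CoVar p\<close> in
    \<open>\<Gamma>\<close>, so the true formula is some \<open>Var p\<close> whose complement also
    occurs.\<close>
  obtain A where "A \<in># \<Gamma>" "eval (\<lambda>p. CoVar p \<in># \<Gamma>) A"
    using assms(1) unfolding valid_sequent_def by blast
  with lit obtain p where "Var p \<in># \<Gamma>" "CoVar p \<in># \<Gamma>"
    by fastforce
  then have "{# Var p, CoVar p #} \<subseteq># \<Gamma>"
    by (auto simp: insert_subset_eq_iff in_diff_count)
  then show ?thesis by auto
qed

text \<open>Passing to a subsequent makes up for the absence of weakening: a valid sequent such as
  P, \<not>P, Q is not itself derivable.\<close>

theorem valid_sequent_has_Mp_subsequent:
  assumes "valid_sequent \<Gamma>"
  shows "\<exists>S. S \<subseteq># \<Gamma> \<and> Mp S"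
  using assms
proof (induction "\<Sum>A\<in>#\<Gamma>. size A" arbitrary: \<Gamma> rule: less_induct)
  case less
  show ?case
  proof (cases "\<forall>A\<in>#\<Gamma>. \<exists>p. A = Var p \<or> A = CoVar p")
    case True
    then obtain p where "{# Var p, neg (Var p) #} \<subseteq># \<Gamma>"
      using valid_sequent_literals[OF less.prems] by auto
    with Mp.ax[of p] show ?thesis
      by (intro exI conjI)
  next
    case False
    then obtain C where C: "C \<in># \<Gamma>" "\<And>p. C \<noteq> Var p \<and> C \<noteq> CoVar p"
      by blast
    then obtain G where G: "\<Gamma> = add_mset C G"
      by (meson mset_add)
    have in_G: ?thesis if "Mp U" "U \<subseteq># G" for U
      using that by (intro exI[of _ U]) (simp add: G subset_mset.order_trans[of U G])
    have add_C: ?thesis if "Mp (add_mset C U)" "U \<subseteq># G" for U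
      using that by (intro exI[of _ "add_mset C U"]) (simp add: G)
    show ?thesis
    proof (cases C)
      case (And A B)
      have "valid_sequent (add_mset A G)" "valid_sequent (add_mset B G)"
        using less.prems unfolding valid_sequent_def G And by auto
      then obtain S T
        where S: "S \<subseteq># add_mset A G" "Mp S" and T: "T \<subseteq># add_mset B G" "Mp T"
        using less.hyps[of "add_mset A G"] less.hyps[of "add_mset B G"] by (auto simp: G And)
      show ?thesis
        using S(1)
      proof (cases rule: subseteq_add_mset_cases)
        case 1
        then show ?thesis
          using S(2) by (intro in_G)
      next
        case (2 S')
        note S' = this
        show ?thesis
          using T(1)
        proof (cases rule: subseteq_add_mset_cases)
          case 1
          then show ?thesis
            using T(2) by (intro in_G)
        next
          \<comment> \<open>\<open>S' \<union># T'\<close> is the least upper bound of two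
            submultisets of \<open>G\<close>, hence still inside \<open>G\<close>; their sum might
            not be.\<close>
          case (2 T')
          then show ?thesis
            using Mp_conj_union[of A S' B T'] S(2) T(2) S' And by (intro add_C[of "S' \<union># T'"]) simp_all
        qed
      qed
    next
      case (Or A B)
      have "valid_sequent (add_mset A (add_mset B G))"
        using less.prems unfolding valid_sequent_def G Or by auto
      then obtain S where S: "S \<subseteq># add_mset A (add_mset B G)" "Mp S"
        using less.hyps[of "add_mset A (add_mset B G)"] by (auto simp: G Or)
      \<comment> \<open>The disjuncts that survive in \<open>S\<close> select the rule: none for
        neither, \<open>oplus2\<close> for \<open>B\<close> alone, \<open>oplus1\<close> for
        \<open>A\<close> alone, \<open>par\<close> for both.\<close>
      show ?thesis
        using S(1)
      proof (cases rule: subseteq_add_mset_cases)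
        case 1
        then show ?thesis
        proof (cases rule: subseteq_add_mset_cases)
          case 1
          then show ?thesis
            using S(2) by (intro in_G)
        next
          case (2 U)
          then show ?thesis
            using Mp.oplus2[of U B A] S(2) Or by (intro add_C[of U]) simp_all
        qed
      next
        case (2 T)
        from 2(2) show ?thesis
        proof (cases rule: subseteq_add_mset_cases)
          case 1
          then show ?thesis
            using Mp.oplus1[of T A B] S(2) 2(1) Or by (intro add_C[of T]) simp_all
        next
          case (2 U)
          then show ?thesis
            using Mp.par[of U A B] S(2) \<open>S = add_mset A T\<close> Or by (intro add_C[of U]) simp_all
        qed
      qed
    qed (use C(2) in auto)
  qed
qed

theorem theorem1:
  fixes A :: "'v form"
  assumes "valid A"
  shows "derivable A"
proof -
  have "valid_sequent {# A #}"
    using assms by (simp add: valid_def valid_sequent_def)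
  then obtain S where "S \<subseteq># {# A #}" "Mp S"
    using valid_sequent_has_Mp_subsequent by blast
  then show ?thesis
    unfolding derivable_def using Mp_nonempty[of S] by (cases S) auto
qed

end
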